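(* Let $m,n\ge1$ and let $A_j,B_j$ ($1\le j\le m$) be $n\times n$ complex positive definite matrices. Then \begin{align*} 2\Big(\sum_{j=1}^{m}(A_j\sharp B_j)\Big)\otimes\Big(\sum_{j=1}^{m}(A_j\sharp B_j)\Big) &\le\Big(\sum_{j=1}^{m}(A_j\sharp_sB_j)\Big)\otimes\Big(\sum_{j=1}^{m}(A_j\sharp_{1-s}B_j)\Big)+\Big(\sum_{j=1}^{m}(A_j\sharp_{1-s}B_j)\Big)\otimes\Big(\sum_{j=1}^{m}(A_j\sharp_sB_j)\Big)\\ &\le\Big(\sum_{j=1}^{m}(A_j\sharp_tB_j)\Big)\otimes\Big(\sum_{j=1}^{m}(A_j\sharp_{1-t}B_j)\Big)+\Big(\sum_{j=1}^{m}(A_j\sharp_{1-t}B_j)\Big)\otimes\Big(\sum_{j=1}^{m}(A_j\sharp_tB_j)\Big)\\ &\le\Big(\sum_{j=1}^{m}A_j\Big)\otimes\Big(\sum_{j=1}^{m}B_j\Big)+\Big(\sum_{j=1}^{m}B_j\Big)\otimes\Big(\sum_{j=1}^{m}A_j\Big) \end{align*} whenever $0\le t\le s\le\frac12$ or $\frac12\le s\le t\le1$.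
   Context: $\otimes$ is the tensor (Kronecker) product of matrices, and $\le$ is the Loewner order on Hermitian matrices ($X\le Y$ iff $Y-X$ is positive semidefinite). For positive definite $A,B$ and $0\le p\le1$, $A\sharp_pB=A^{1/2}(A^{-1/2}BA^{-1/2})^{p}A^{1/2}$ and $A\sharp B=A\sharp_{1/2}B$. *)

theory Defs
  imports "HOL-Analysis.Analysis"
begin

definition adjoint_mat :: "complex ^ 'n ^ 'm \<Rightarrow> complex ^ 'm ^ 'n" where
  "adjoint_mat A = (\<chi> i j. cnj (A $ j $ i))"

definition hermitian_mat :: "complex ^ 'n ^ 'n \<Rightarrow> bool" where
  "hermitian_mat A \<longleftrightarrow> adjoint_mat A = A"

definition unitary_mat :: "complex ^ 'n ^ 'n \<Rightarrow> bool" where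
  "unitary_mat U \<longleftrightarrow> adjoint_mat U ** U = mat 1 \<and> U ** adjoint_mat U = mat 1"

definition diag_mat :: "('n \<Rightarrow> complex) \<Rightarrow> complex ^ 'n ^ 'n" where
  "diag_mat d = (\<chi> i j. if i = j then d i else 0)"

definition quad_form :: "complex ^ 'n ^ 'n \<Rightarrow> complex ^ 'n \<Rightarrow> complex" where
  "quad_form A x = (\<Sum>i\<in>UNIV. cnj (x $ i) * (A *v x) $ i)"

text \<open>The quadratic form of a Hermitian matrix is real-valued, so passing to the real part
  below loses nothing.\<close>

definition pos_semidef :: "complex ^ 'n ^ 'n \<Rightarrow> bool" where
  "pos_semidef A \<longleftrightarrow> hermitian_mat A \<and> (\<forall>x. 0 \<le> Re (quad_form A x))"

definition pos_def :: "complex ^ 'n ^ 'n \<Rightarrow> bool" where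
  "pos_def A \<longleftrightarrow> hermitian_mat A \<and> (\<forall>x. x \<noteq> 0 \<longrightarrow> 0 < Re (quad_form A x))"

definition loewner_le :: "complex ^ 'n ^ 'n \<Rightarrow> complex ^ 'n ^ 'n \<Rightarrow> bool"
    (infix "\<preceq>\<^sub>L" 50) where
  "X \<preceq>\<^sub>L Y \<longleftrightarrow> hermitian_mat X \<and> hermitian_mat Y \<and> pos_semidef (Y - X)"

text \<open>Real powers of a positive definite matrix by the spectral functional calculus: if
  \<open>A = U diag(d) U\<^sup>*\<close> with \<open>U\<close> unitary and \<open>d > 0\<close>, then \<open>A\<^sup>p = U diag(d\<^sup>p) U\<^sup>*\<close>. Such a
  decomposition exists for every positive definite \<open>A\<close> by the spectral theorem, and the result
  does not depend on its choice. For other \<open>A\<close> the value is unspecified.\<close>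

definition mat_powr :: "complex ^ 'n ^ 'n \<Rightarrow> real \<Rightarrow> complex ^ 'n ^ 'n" where
  "mat_powr A p = (THE X. \<exists>U d. unitary_mat U \<and> (\<forall>i. 0 < d i) \<and>
      A = U ** diag_mat (\<lambda>i. complex_of_real (d i)) ** adjoint_mat U \<and>
      X = U ** diag_mat (\<lambda>i. complex_of_real (d i powr p)) ** adjoint_mat U)"

definition wgeo_mean :: "complex ^ 'n ^ 'n \<Rightarrow> real \<Rightarrow> complex ^ 'n ^ 'n \<Rightarrow> complex ^ 'n ^ 'n"
    ("(_ \<sharp>[_] _)" [76, 0, 76] 75) where
  "A \<sharp>[p] B = mat_powr A (1/2) **
      mat_powr (mat_powr A (-1/2) ** B ** mat_powr A (-1/2)) p ** mat_powr A (1/2)"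

abbreviation geo_mean :: "complex ^ 'n ^ 'n \<Rightarrow> complex ^ 'n ^ 'n \<Rightarrow> complex ^ 'n ^ 'n"
    (infix "\<sharp>" 75) where
  "A \<sharp> B \<equiv> A \<sharp>[1/2] B"

text \<open>Rows and columns of the Kronecker product are indexed by pairs instead of being
  enumerated in lexicographic order.\<close>

definition kronecker :: "complex ^ 'n ^ 'm \<Rightarrow> complex ^ 'l ^ 'k \<Rightarrow> complex ^ ('n \<times> 'l) ^ ('m \<times> 'k)"
    (infixr "\<otimes>\<^sub>K" 70) where
  "A \<otimes>\<^sub>K B = (\<chi> p q. A $ fst p $ fst q * B $ snd p $ snd q)"

end

theory Submission
  imports Defs
begin

text \<open>
  Expand all the Kronecker products of sums into double sums. It turns out that the inequalities
  already hold for each pair of indices \<open>(i, j)\<close> separately, and adding them over all pairs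
  gives the theorem.

  The reason is that a pair of positive definite matrices can be diagonalized simultaneously by a
  congruence: \<open>A = P P\<^sup>*\<close> and \<open>B = P D P\<^sup>*\<close> with \<open>D\<close> diagonal and positive, and then
  \<open>A \<sharp>[p] B = P D\<^sup>p P\<^sup>*\<close> for every \<open>p\<close> (\<open>wgeo_mean_diagonalization\<close>). If \<open>P, D\<close> belong to
  \<open>(A\<^sub>i, B\<^sub>i)\<close> and \<open>Q, E\<close> to \<open>(A\<^sub>j, B\<^sub>j)\<close>, the mixed product rule gives
  \<open>(A\<^sub>i \<sharp>[s] B\<^sub>i) \<otimes> (A\<^sub>j \<sharp>[1-s] B\<^sub>j) + (A\<^sub>i \<sharp>[1-s] B\<^sub>i) \<otimes> (A\<^sub>j \<sharp>[s] B\<^sub>j)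
    = (P \<otimes> Q) (D\<^sup>s \<otimes> E\<^bsup>1-s\<^esup> + D\<^bsup>1-s\<^esup> \<otimes> E\<^sup>s) (P \<otimes> Q)\<^sup>*\<close>,
  a congruence, independent of \<open>s\<close>, of a diagonal matrix. Its entries are the Heinz sums
  \<open>a\<^sup>s b\<^bsup>1-s\<^esup> + a\<^bsup>1-s\<^esup> b\<^sup>s = 2 \<surd>(ab) cosh ((s - 1/2) ln (a/b))\<close>, which grow with the distance
  of \<open>s\<close> from \<open>1/2\<close>. Hence so does the whole expression in the Loewner order
  (\<open>loewner_Heinz_kronecker_sum\<close>), and the three inequalities compare the parameters
  \<open>1/2\<close>, \<open>s\<close>, \<open>t\<close> and \<open>0\<close>, since \<open>A \<sharp>[0] B = A\<close> and \<open>A \<sharp>[1] B = B\<close>.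

  The diagonalization rests on the spectral theorem for Hermitian matrices, which is proved by
  maximizing the Rayleigh quotient on the orthogonal complement of the eigenvectors already found.
\<close>

section \<open>The Hermitian inner product and the adjoint\<close>

definition herm_inner :: "complex ^ 'n \<Rightarrow> complex ^ 'n \<Rightarrow> complex" where
  "herm_inner x y = (\<Sum>i\<in>UNIV. cnj (x $ i) * y $ i)"

lemma quad_form_eq_herm_inner: "quad_form A x = herm_inner x (A *v x)"
  by (simp add: quad_form_def herm_inner_def)

lemma Re_herm_inner: "Re (herm_inner x y) = x \<bullet> y"
  by (simp add: herm_inner_def inner_vec_def inner_complex_def)

lemma cnj_herm_inner: "cnj (herm_inner x y) = herm_inner y x"
  by (simp add: herm_inner_def mult.commute)

lemma herm_inner_add_right: "herm_inner x (y + z) = herm_inner x y + herm_inner x z"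
  by (simp add: herm_inner_def algebra_simps sum.distrib)

lemma herm_inner_scaleR_right: "herm_inner x (c *\<^sub>R y) = of_real c * herm_inner x y"
  by (simp add: herm_inner_def scaleR_conv_of_real[where 'a=complex] sum_distrib_left algebra_simps)

lemma herm_inner_scaleR_left: "herm_inner (c *\<^sub>R x) y = of_real c * herm_inner x y"
  by (simp add: herm_inner_def scaleR_conv_of_real[where 'a=complex] sum_distrib_left algebra_simps)

lemma herm_inner_self: "herm_inner x x = of_real (x \<bullet> x)"
  by (rule complex_eqI)
    (simp_all add: Re_herm_inner, simp add: herm_inner_def mult.commute)

lemma herm_inner_matrix_vector_mult:
  "herm_inner (A *v x) y = herm_inner x (adjoint_mat A *v y)"
proof -
  have "herm_inner (A *v x) y = (\<Sum>i\<in>UNIV. \<Sum>j\<in>UNIV. cnj (A $ i $ j) * cnj (x $ j) * y $ i)"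
    by (simp add: herm_inner_def matrix_vector_mult_def sum_distrib_right)
  also have "\<dots> = (\<Sum>j\<in>UNIV. \<Sum>i\<in>UNIV. cnj (A $ i $ j) * cnj (x $ j) * y $ i)"
    by (rule sum.swap)
  also have "\<dots> = herm_inner x (adjoint_mat A *v y)"
    by (simp add: herm_inner_def matrix_vector_mult_def adjoint_mat_def sum_distrib_left mult_ac)
  finally show ?thesis .
qed

lemma adjoint_mat_mult: "adjoint_mat (A ** B) = adjoint_mat B ** adjoint_mat A"
  by (simp add: adjoint_mat_def matrix_matrix_mult_def vec_eq_iff mult.commute)

lemma adjoint_mat_adjoint_mat [simp]: "adjoint_mat (adjoint_mat A) = A"
  by (simp add: adjoint_mat_def vec_eq_iff)

lemma adjoint_mat_add: "adjoint_mat (A + B) = adjoint_mat A + adjoint_mat B"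
  by (simp add: adjoint_mat_def vec_eq_iff)

lemma matrix_diff_ldistrib: "A ** (B - C) = A ** B - A ** C"
  for A :: "complex ^ 'n ^ 'm"
  by (simp add: matrix_matrix_mult_def vec_eq_iff algebra_simps sum_subtractf)

lemma matrix_diff_rdistrib: "(B - C) ** A = B ** A - C ** A"
  for A :: "complex ^ 'n ^ 'm"
  by (simp add: matrix_matrix_mult_def vec_eq_iff algebra_simps sum_subtractf)

lemma matrix_add_rdistrib_complex: "(B + C) ** A = B ** A + C ** A"
  for A :: "complex ^ 'n ^ 'm"
  by (simp add: matrix_matrix_mult_def vec_eq_iff algebra_simps sum.distrib)

section \<open>Diagonal matrices\<close>

lemma matrix_mult_diag_nth: "(A ** diag_mat d) $ i $ j = A $ i $ j * d j"
  by (simp add: matrix_matrix_mult_def diag_mat_def if_distrib cong: if_cong)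

lemma diag_matrix_mult_nth: "(diag_mat d ** A) $ i $ j = d i * A $ i $ j"
  by (simp add: matrix_matrix_mult_def diag_mat_def if_distrib[of "\<lambda>x. x * _"] cong: if_cong)

lemma diag_mat_mult: "diag_mat d ** diag_mat e = diag_mat (\<lambda>i. d i * e i)"
  by (simp add: vec_eq_iff matrix_mult_diag_nth) (simp add: diag_mat_def)

lemma diag_mat_one: "diag_mat (\<lambda>_. 1) = mat 1"
  by (simp add: diag_mat_def mat_def)

lemma adjoint_diag_mat: "adjoint_mat (diag_mat d) = diag_mat (\<lambda>i. cnj (d i))"
  by (simp add: adjoint_mat_def diag_mat_def vec_eq_iff)

lemma quad_form_diag_mat:
  "Re (quad_form (diag_mat (\<lambda>i. complex_of_real (d i))) x) = (\<Sum>i\<in>UNIV. d i * (cmod (x $ i))\<^sup>2)"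
proof -
  have "(diag_mat (\<lambda>i. complex_of_real (d i)) *v x) $ i = of_real (d i) * x $ i" for i
    by (simp add: matrix_vector_mult_def diag_mat_def if_distrib[of "\<lambda>x. x * _"] cong: if_cong)
  then show ?thesis
    by (simp add: quad_form_def cmod_def power2_eq_square algebra_simps)
qed

section \<open>The Loewner order\<close>

lemma quad_form_congruence:
  "quad_form (C ** M ** adjoint_mat C) x = quad_form M (adjoint_mat C *v x)"
  by (simp add: quad_form_eq_herm_inner herm_inner_matrix_vector_mult matrix_vector_mul_assoc
      matrix_mul_assoc)

lemma pos_semidef_congruence:
  assumes "pos_semidef M"
  shows "pos_semidef (C ** M ** adjoint_mat C)"
  using assms
  by (simp add: pos_semidef_def hermitian_mat_def quad_form_congruence adjoint_mat_mult
      matrix_mul_assoc)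

lemma pos_semidef_add: "pos_semidef M \<Longrightarrow> pos_semidef N \<Longrightarrow> pos_semidef (M + N)"
  by (simp add: pos_semidef_def hermitian_mat_def adjoint_mat_add quad_form_eq_herm_inner
      herm_inner_add_right matrix_vector_mult_add_rdistrib)

lemma pos_semidef_zero: "pos_semidef 0"
  by (simp add: pos_semidef_def hermitian_mat_def adjoint_mat_def vec_eq_iff quad_form_def)

lemma loewner_le_congruence:
  assumes "X \<preceq>\<^sub>L Y"
  shows "C ** X ** adjoint_mat C \<preceq>\<^sub>L C ** Y ** adjoint_mat C"
  using assms pos_semidef_congruence[of "Y - X" C]
  by (simp add: loewner_le_def hermitian_mat_def adjoint_mat_mult matrix_mul_assoc
      matrix_diff_ldistrib matrix_diff_rdistrib)

lemma loewner_le_add: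
  assumes "X \<preceq>\<^sub>L Y" "X' \<preceq>\<^sub>L Y'"
  shows "X + X' \<preceq>\<^sub>L Y + Y'"
  using assms pos_semidef_add[of "Y - X" "Y' - X'"]
  by (simp add: loewner_le_def hermitian_mat_def adjoint_mat_add algebra_simps)

lemma loewner_le_sum:
  fixes X Y :: "'k \<Rightarrow> complex ^ 'n ^ 'n"
  assumes "\<And>i. i \<in> I \<Longrightarrow> X i \<preceq>\<^sub>L Y i"
  shows "(\<Sum>i\<in>I. X i) \<preceq>\<^sub>L (\<Sum>i\<in>I. Y i)"
proof -
  have zero: "0 \<preceq>\<^sub>L (0 :: complex ^ 'n ^ 'n)"
    using pos_semidef_zero by (simp add: loewner_le_def pos_semidef_def)
  show ?thesis
    using assms
    by (induction I rule: infinite_finite_induct) (auto simp: zero intro: loewner_le_add)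
qed

lemma loewner_le_diag_mat:
  assumes "\<And>i. d i \<le> e i"
  shows "diag_mat (\<lambda>i. complex_of_real (d i)) \<preceq>\<^sub>L diag_mat (\<lambda>i. complex_of_real (e i))"
proof -
  have diff: "diag_mat (\<lambda>i. complex_of_real (e i)) - diag_mat (\<lambda>i. complex_of_real (d i))
      = diag_mat (\<lambda>i. complex_of_real (e i - d i))"
    by (simp add: diag_mat_def vec_eq_iff)
  show ?thesis
    unfolding loewner_le_def pos_semidef_def diff quad_form_diag_mat hermitian_mat_def
      adjoint_diag_mat
    using assms by (auto intro!: sum_nonneg)
qed

section \<open>The spectral theorem\<close>

text \<open>
  The vectors orthogonal to \<open>u j\<close> for all \<open>j \<in> I\<close> form the kernel of the square matrix with the
  adjoints of these \<open>u j\<close> as rows and zero rows elsewhere. As \<open>i\<close> labels a zero row, the matrix is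
  singular.
\<close>

lemma exists_orthogonal_vector:
  fixes u :: "'n::finite \<Rightarrow> complex ^ 'n"
  assumes "i \<notin> I"
  shows "\<exists>x. x \<noteq> 0 \<and> (\<forall>j\<in>I. herm_inner (u j) x = 0)"
proof -
  define M :: "complex ^ 'n ^ 'n" where "M = (\<chi> j k. if j \<in> I then cnj (u j $ k) else 0)"
  have "row i M = 0"
    using assms by (simp add: row_def M_def vec_eq_iff)
  then have "\<not> invertible M"
    using det_zero_row(2)[of i M] by (simp add: invertible_det_nz)
  then obtain x where x: "M *v x = 0" "x \<noteq> 0"
    using matrix_left_invertible_ker[of M] by (auto simp: invertible_left_inverse)
  have "herm_inner (u j) x = 0" if "j \<in> I" for j
  proof -
    have "herm_inner (u j) x = (M *v x) $ j"
      using that by (simp add: herm_inner_def M_def matrix_vector_mult_def)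
    then show ?thesis using x by simp
  qed
  then show ?thesis using x by blast
qed

text \<open>
  The first-order condition at a maximum of the Rayleigh quotient, in a form that avoids
  derivatives. The residual \<open>z = f x - c x\<close> is itself an admissible direction, and moving from \<open>x\<close>
  by \<open>\<epsilon> z\<close> changes the nonnegative form \<open>c |y|\<^sup>2 - \<langle>y, f y\<rangle>\<close>, which vanishes at \<open>x\<close>, by
  \<open>- 2 \<epsilon> |z|\<^sup>2 + O(\<epsilon>\<^sup>2)\<close>. So \<open>z\<close> must be \<open>0\<close>.
\<close>

lemma Rayleigh_maximizer_eigenvector:
  fixes f :: "'a::real_inner \<Rightarrow> 'a"
  assumes f: "linear f" and W: "subspace W" "\<And>y. y \<in> W \<Longrightarrow> f y \<in> W"
    and symm: "\<And>y z. f y \<bullet> z = y \<bullet> f z"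
    and x: "x \<in> W" "x \<bullet> f x = c * (x \<bullet> x)"
    and bound: "\<And>y. y \<in> W \<Longrightarrow> y \<bullet> f y \<le> c * (y \<bullet> y)"
  shows "f x = c *\<^sub>R x"
proof (rule ccontr)
  define z where "z = f x - c *\<^sub>R x"
  define g where "g y = c * (y \<bullet> y) - y \<bullet> f y" for y
  assume "f x \<noteq> c *\<^sub>R x"
  then have z0: "z \<bullet> z > 0" by (simp add: z_def)
  have zW: "z \<in> W"
    using W x by (simp add: z_def subspace_diff subspace_scale)
  then have gz: "g z \<ge> 0" using bound by (simp add: g_def)
  \<comment> \<open>Any positive \<open>\<epsilon>\<close> with \<open>\<epsilon> g(z) < 2 |z|\<^sup>2\<close> works; adding \<open>1\<close> covers the case \<open>g(z) = 0\<close>.\<close>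
  define \<epsilon> where "\<epsilon> = (z \<bullet> z) / (g z + 1)"
  have eps: "\<epsilon> > 0" "\<epsilon> * g z < z \<bullet> z"
    using z0 gz by (auto simp: \<epsilon>_def field_simps)
  have "x + \<epsilon> *\<^sub>R z \<in> W"
    using W x zW by (simp add: subspace_add subspace_scale)
  then have "0 \<le> g (x + \<epsilon> *\<^sub>R z)"
    using bound by (simp add: g_def)
  also have "g (x + \<epsilon> *\<^sub>R z) = - 2 * \<epsilon> * (z \<bullet> f x - c * (z \<bullet> x)) + \<epsilon>\<^sup>2 * g z"
  proof -
    have "x \<bullet> f z = z \<bullet> f x"
      using symm[of x z] by (simp add: inner_commute)
    then show ?thesis
      using x(2)
      by (simp add: g_def linear_add[OF f] linear_scale[OF f] inner_add inner_commute[of x z]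
          power2_eq_square algebra_simps)
  qed
  also have "z \<bullet> f x - c * (z \<bullet> x) = z \<bullet> z"
    by (simp add: z_def inner_diff)
  also have "- 2 * \<epsilon> * (z \<bullet> z) + \<epsilon>\<^sup>2 * g z = \<epsilon> * (\<epsilon> * g z - 2 * (z \<bullet> z))"
    by (simp add: power2_eq_square algebra_simps)
  also have "\<dots> < 0"
    using eps z0 by (intro mult_pos_neg) linarith+
  finally show False by simp
qed

lemma hermitian_mat_inner:
  assumes "hermitian_mat A"
  shows "herm_inner (A *v x) y = herm_inner x (A *v y)"
  using assms herm_inner_matrix_vector_mult[of A x y] by (simp add: hermitian_mat_def)

text \<open>
  The orthogonal complement \<open>W\<close> of a set of eigenvectors is invariant under \<open>A\<close>, because \<open>A\<close> is
  Hermitian. The Rayleigh quotient attains its maximum on the compact unit sphere of \<open>W\<close>, and it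
  does so at an eigenvector. Here \<open>W\<close> is treated as a real subspace with the real inner product, the
  real part of the Hermitian one.
\<close>

lemma hermitian_eigenvector_orthogonal:
  fixes A :: "complex ^ 'n ^ 'n" and u :: "'n \<Rightarrow> complex ^ 'n"
  assumes A: "hermitian_mat A" and "i \<notin> I"
    and eig: "\<And>j. j \<in> I \<Longrightarrow> A *v u j = e j *\<^sub>R u j"
  shows "\<exists>x c. herm_inner x x = 1 \<and> A *v x = c *\<^sub>R x \<and> (\<forall>j\<in>I. herm_inner (u j) x = 0)"
proof -
  define W where "W = {x. \<forall>j\<in>I. herm_inner (u j) x = 0}"
  have sub: "subspace W"
    unfolding subspace_def W_def
    by (auto simp: herm_inner_add_right herm_inner_scaleR_right) (simp add: herm_inner_def)
  have inv: "A *v y \<in> W" if "y \<in> W" for y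
    using that eig
    by (auto simp: W_def hermitian_mat_inner[OF A, symmetric] herm_inner_scaleR_left)
  have lin: "linear (\<lambda>x. A *v x)"
    by (rule matrix_vector_mul_linear)
  have symm: "(A *v y) \<bullet> z = y \<bullet> (A *v z)" for y z
    by (simp flip: Re_herm_inner add: hermitian_mat_inner[OF A])
  obtain w where w: "w \<in> W" "w \<noteq> 0"
    using exists_orthogonal_vector[OF \<open>i \<notin> I\<close>, of u] by (auto simp: W_def)
  have unit: "y /\<^sub>R norm y \<in> sphere 0 1 \<inter> W" if "y \<in> W" "y \<noteq> 0" for y
    using that sub by (simp add: subspace_scale)
  have "compact (sphere 0 1 \<inter> W)"
    using closed_subspace[OF sub] by (intro compact_Int_closed) auto
  moreover have "sphere 0 1 \<inter> W \<noteq> {}"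
    using unit[OF w] by blast
  moreover have "continuous_on (sphere 0 1 \<inter> W) (\<lambda>x. x \<bullet> (A *v x))"
    by (intro continuous_intros linear_continuous_on linear_conv_bounded_linear[THEN iffD1] lin)
  ultimately obtain x where x: "x \<in> sphere 0 1 \<inter> W"
    and max: "\<And>y. y \<in> sphere 0 1 \<inter> W \<Longrightarrow> y \<bullet> (A *v y) \<le> x \<bullet> (A *v x)"
    using continuous_attains_sup by meson
  have xx: "x \<bullet> x = 1"
    using x by (simp add: dot_square_norm)
  define c where "c = x \<bullet> (A *v x)"
  have bound: "y \<bullet> (A *v y) \<le> c * (y \<bullet> y)" if "y \<in> W" for y
  proof (cases "y = 0")
    case False
    have "(y /\<^sub>R norm y) \<bullet> (A *v (y /\<^sub>R norm y)) \<le> c"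
      using max[OF unit[OF that False]] by (simp add: c_def)
    then have "(y \<bullet> (A *v y)) / (norm y)\<^sup>2 \<le> c"
      using linear_scale[OF lin, of "inverse (norm y)" y]
      by (simp add: power2_eq_square field_simps)
    then show ?thesis
      using False by (simp add: divide_le_eq dot_square_norm)
  qed (simp add: linear_0[OF lin])
  have "x \<in> W" "x \<bullet> (A *v x) = c * (x \<bullet> x)"
    using x by (auto simp: c_def xx)
  then have "A *v x = c *\<^sub>R x"
    using Rayleigh_maximizer_eigenvector[OF lin sub inv symm _ _ bound] by blast
  then show ?thesis
    using x xx by (intro exI[of _ x] exI[of _ c]) (simp add: herm_inner_self W_def)
qed

text \<open>
  Labelling the eigenvectors by the index type of the matrix itself lets them be read off as the
  columns of a square matrix once \<open>I\<close> is the whole type.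
\<close>

lemma hermitian_orthonormal_eigenvectors:
  fixes A :: "complex ^ 'n ^ 'n" and I :: "'n set"
  assumes A: "hermitian_mat A" and "finite I"
  shows "\<exists>(u :: 'n \<Rightarrow> complex ^ 'n) e. (\<forall>i\<in>I. A *v u i = e i *\<^sub>R u i) \<and>
    (\<forall>i\<in>I. \<forall>j\<in>I. herm_inner (u i) (u j) = (if i = j then 1 else 0))"
  using \<open>finite I\<close>
proof (induction I)
  case (insert i I)
  then obtain u :: "'n \<Rightarrow> complex ^ 'n" and e where
    eig: "\<And>j. j \<in> I \<Longrightarrow> A *v u j = e j *\<^sub>R u j" and
    orth: "\<And>j k. j \<in> I \<Longrightarrow> k \<in> I \<Longrightarrow> herm_inner (u j) (u k) = (if j = k then 1 else 0)"
    by blast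
  obtain x c where x: "herm_inner x x = 1" "A *v x = c *\<^sub>R x"
      "\<And>j. j \<in> I \<Longrightarrow> herm_inner (u j) x = 0"
    using hermitian_eigenvector_orthogonal[where u = u and e = e, OF A insert.hyps(2) eig] by blast
  have x': "herm_inner x (u j) = 0" if "j \<in> I" for j
    using x(3)[OF that] cnj_herm_inner[of "u j" x] by simp
  show ?case
    using insert.hyps eig orth x x'
    by (intro exI[of _ "u(i := x)"] exI[of _ "e(i := c)"]) auto
qed simp

theorem hermitian_spectral_decomposition:
  fixes A :: "complex ^ 'n ^ 'n"
  assumes "hermitian_mat A"
  shows "\<exists>U d. unitary_mat U \<and> A = U ** diag_mat (\<lambda>i. complex_of_real (d i)) ** adjoint_mat U"
proof -
  obtain u :: "'n \<Rightarrow> complex ^ 'n" and d where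
    eig: "\<And>i. A *v u i = d i *\<^sub>R u i" and
    orth: "\<And>i j. herm_inner (u i) (u j) = (if i = j then 1 else 0)"
    using hermitian_orthonormal_eigenvectors[OF assms, of UNIV] by auto
  define U :: "complex ^ 'n ^ 'n" where "U = (\<chi> k i. u i $ k)"
  have UU: "adjoint_mat U ** U = mat 1"
    using orth by (simp add: U_def adjoint_mat_def matrix_matrix_mult_def mat_def vec_eq_iff
        herm_inner_def)
  then have U: "unitary_mat U"
    by (simp add: unitary_mat_def matrix_left_right_inverse)
  have "A ** U = U ** diag_mat (\<lambda>i. complex_of_real (d i))"
  proof -
    have "(A ** U) $ k $ i = (A *v u i) $ k" for k i
      by (simp add: U_def matrix_matrix_mult_def matrix_vector_mult_def)
    then show ?thesis
      by (simp add: vec_eq_iff matrix_mult_diag_nth eig)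
        (simp add: U_def scaleR_conv_of_real[where 'a=complex] mult.commute)
  qed
  then have "A ** (U ** adjoint_mat U) = U ** diag_mat (\<lambda>i. complex_of_real (d i)) ** adjoint_mat U"
    by (simp add: matrix_mul_assoc)
  then show ?thesis
    using U by (auto simp: unitary_mat_def)
qed

section \<open>Powers and weighted geometric means\<close>

lemma quad_form_unitary_congruence:
  "unitary_mat U \<Longrightarrow> quad_form (U ** M ** adjoint_mat U) (U *v x) = quad_form M x"
  by (simp add: quad_form_congruence matrix_vector_mul_assoc unitary_mat_def)

lemma pos_def_spectral_decomposition:
  fixes A :: "complex ^ 'n ^ 'n"
  assumes "pos_def A"
  obtains U d where "unitary_mat U" "\<And>i. 0 < d i"
    "A = U ** diag_mat (\<lambda>i. complex_of_real (d i)) ** adjoint_mat U"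
proof -
  obtain U d where U: "unitary_mat U"
    and A: "A = U ** diag_mat (\<lambda>i. complex_of_real (d i)) ** adjoint_mat U"
    using hermitian_spectral_decomposition assms unfolding pos_def_def by blast
  \<comment> \<open>The eigenvalue \<open>d i\<close> is the value of the quadratic form at the \<open>i\<close>-th column of \<open>U\<close>.\<close>
  have "0 < d i" for i
  proof -
    let ?e = "axis i 1 :: complex ^ 'n"
    have "adjoint_mat U *v (U *v ?e) = ?e"
      using U by (simp add: matrix_vector_mul_assoc unitary_mat_def)
    then have "U *v ?e \<noteq> 0"
      using axis_eq_0_iff[of i "1::complex"] by auto
    then have "0 < Re (quad_form A (U *v ?e))"
      using assms by (simp add: pos_def_def)
    also have "\<dots> = d i"
      by (simp add: A quad_form_unitary_congruence[OF U] quad_form_diag_mat axis_def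
          if_distrib[of cmod] if_distrib[of "\<lambda>x. x\<^sup>2"] if_distrib[of "\<lambda>x. _ * x"] cong: if_cong)
    finally show ?thesis .
  qed
  then show thesis using U A that by blast
qed

text \<open>
  The functional calculus does not depend on the diagonalization. If \<open>W = V\<^sup>* U\<close> intertwines
  \<open>diag d\<close> with \<open>diag e\<close>, then \<open>d j = e i\<close> wherever the entry \<open>W i j\<close> is nonzero, so \<open>W\<close> also
  intertwines any function of the two diagonals.
\<close>

lemma spectral_calculus_unique:
  fixes f :: "real \<Rightarrow> real"
  assumes U: "unitary_mat U" and V: "unitary_mat V"
    and eq: "U ** diag_mat (\<lambda>i. complex_of_real (d i)) ** adjoint_mat U
      = V ** diag_mat (\<lambda>i. complex_of_real (e i)) ** adjoint_mat V"
  shows "U ** diag_mat (\<lambda>i. complex_of_real (f (d i))) ** adjoint_mat U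
      = V ** diag_mat (\<lambda>i. complex_of_real (f (e i))) ** adjoint_mat V"
proof -
  define W where "W = adjoint_mat V ** U"
  let ?D = "\<lambda>f. diag_mat (\<lambda>i. complex_of_real (f (d i)))"
  let ?E = "\<lambda>f. diag_mat (\<lambda>i. complex_of_real (f (e i)))"
  have UU: "M ** adjoint_mat U ** U = M" for M :: "complex ^ 'a ^ 'a"
    using U by (simp flip: matrix_mul_assoc add: unitary_mat_def)
  have "W ** ?D (\<lambda>x. x) = adjoint_mat V ** (U ** ?D (\<lambda>x. x) ** adjoint_mat U) ** U"
    by (simp add: W_def matrix_mul_assoc UU)
  also have "\<dots> = (adjoint_mat V ** V) ** ?E (\<lambda>x. x) ** W"
    by (simp add: eq W_def matrix_mul_assoc)
  finally have intertwine: "W ** ?D (\<lambda>x. x) = ?E (\<lambda>x. x) ** W"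
    using V by (simp add: unitary_mat_def)
  have "W ** ?D f = ?E f ** W"
  proof -
    have "W $ i $ j * of_real (f (d j)) = of_real (f (e i)) * W $ i $ j" for i j
      using arg_cong[OF intertwine, of "\<lambda>M. M $ i $ j"]
      by (cases "W $ i $ j = 0") (auto simp: matrix_mult_diag_nth diag_matrix_mult_nth)
    then show ?thesis
      by (simp add: vec_eq_iff matrix_mult_diag_nth diag_matrix_mult_nth)
  qed
  then have "V ** (W ** ?D f) ** adjoint_mat U = V ** (?E f ** W) ** adjoint_mat U"
    by simp
  moreover have "V ** W = U"
    using V by (simp add: W_def matrix_mul_assoc unitary_mat_def)
  moreover have "W ** adjoint_mat U = adjoint_mat V"
    using U by (simp add: W_def flip: matrix_mul_assoc add: unitary_mat_def)
  ultimately show ?thesis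
    by (metis matrix_mul_assoc)
qed

lemma mat_powr_eq:
  assumes "unitary_mat U" "\<And>i. 0 < d i"
    "A = U ** diag_mat (\<lambda>i. complex_of_real (d i)) ** adjoint_mat U"
  shows "mat_powr A p = U ** diag_mat (\<lambda>i. complex_of_real (d i powr p)) ** adjoint_mat U"
  unfolding mat_powr_def
proof (rule the_equality)
  fix X assume "\<exists>V e. unitary_mat V \<and> (\<forall>i. 0 < e i) \<and>
      A = V ** diag_mat (\<lambda>i. complex_of_real (e i)) ** adjoint_mat V \<and>
      X = V ** diag_mat (\<lambda>i. complex_of_real (e i powr p)) ** adjoint_mat V"
  then obtain V e where "unitary_mat V"
      "A = V ** diag_mat (\<lambda>i. complex_of_real (e i)) ** adjoint_mat V"
      "X = V ** diag_mat (\<lambda>i. complex_of_real (e i powr p)) ** adjoint_mat V"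
    by blast
  then show "X = U ** diag_mat (\<lambda>i. complex_of_real (d i powr p)) ** adjoint_mat U"
    using assms spectral_calculus_unique[of V U e d "\<lambda>x. x powr p"] by simp
qed (use assms in blast)

lemma mat_powr_sqrt_inverse:
  fixes A :: "complex ^ 'n ^ 'n"
  assumes "pos_def A"
  defines "R \<equiv> mat_powr A (1/2)" and "S \<equiv> mat_powr A (-1/2)"
  shows "adjoint_mat R = R" "adjoint_mat S = S" "R ** R = A" "R ** S = mat 1" "S ** R = mat 1"
proof -
  obtain U d where U: "unitary_mat U" "\<And>i. 0 < d i"
    "A = U ** diag_mat (\<lambda>i. complex_of_real (d i)) ** adjoint_mat U"
    using pos_def_spectral_decomposition[OF assms(1)] by blast
  have powr: "mat_powr A p = U ** diag_mat (\<lambda>i. complex_of_real (d i powr p)) ** adjoint_mat U" for p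
    using mat_powr_eq[OF U] .
  show "adjoint_mat R = R" "adjoint_mat S = S"
    by (simp_all add: R_def S_def powr adjoint_mat_mult adjoint_diag_mat matrix_mul_assoc)
  have mult: "mat_powr A p ** mat_powr A q = mat_powr A (p + q)" for p q
  proof -
    have "mat_powr A p ** mat_powr A q = U ** (diag_mat (\<lambda>i. complex_of_real (d i powr p)) **
        (adjoint_mat U ** U) ** diag_mat (\<lambda>i. complex_of_real (d i powr q))) ** adjoint_mat U"
      by (simp add: powr matrix_mul_assoc)
    also have "\<dots> = mat_powr A (p + q)"
      using U(1) by (simp add: unitary_mat_def powr diag_mat_mult powr_add)
    finally show ?thesis .
  qed
  have "mat_powr A 1 = A" "mat_powr A 0 = mat 1"
    using U(1) U(3)[symmetric] less_imp_le[OF U(2)] less_imp_neq[OF U(2), THEN not_sym]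
    by (simp_all add: powr diag_mat_one unitary_mat_def)
  then show "R ** R = A" "R ** S = mat 1" "S ** R = mat 1"
    by (simp_all add: R_def S_def mult)
qed

text \<open>
  With \<open>A\<^bsup>-1/2\<^esup> B A\<^bsup>-1/2\<^esup> = V diag(d) V\<^sup>*\<close>, the congruence \<open>P = A\<^bsup>1/2\<^esup> V\<close> carries \<open>diag(d\<^sup>p)\<close> to
  \<open>A \<sharp>[p] B\<close> for all \<open>p\<close> at once; the exponents \<open>0\<close> and \<open>1\<close> recover \<open>A\<close> and \<open>B\<close>.
\<close>

lemma wgeo_mean_diagonalization:
  fixes A B :: "complex ^ 'n ^ 'n"
  assumes A: "pos_def A" and B: "pos_def B"
  obtains P :: "complex ^ 'n ^ 'n" and d where "\<And>i. 0 < d i"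
    "\<And>p. A \<sharp>[p] B = P ** diag_mat (\<lambda>i. complex_of_real (d i powr p)) ** adjoint_mat P"
    "A \<sharp>[0] B = A" "A \<sharp>[1] B = B"
proof -
  define R S where "R = mat_powr A (1/2)" and "S = mat_powr A (-1/2)"
  have R: "adjoint_mat R = R" "R ** R = A" and S: "adjoint_mat S = S"
    and RS: "R ** S = mat 1" "S ** R = mat 1"
    unfolding R_def S_def using mat_powr_sqrt_inverse[OF A] by auto
  have "pos_def (S ** B ** S)"
    unfolding pos_def_def
  proof (intro conjI allI impI)
    show "hermitian_mat (S ** B ** S)"
      using B S by (simp add: pos_def_def hermitian_mat_def adjoint_mat_mult matrix_mul_assoc)
  next
    fix x :: "complex ^ 'n" assume "x \<noteq> 0"
    have "R *v (S *v x) = x"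
      by (simp add: matrix_vector_mul_assoc RS)
    then have "S *v x \<noteq> 0"
      using \<open>x \<noteq> 0\<close> by auto
    then show "0 < Re (quad_form (S ** B ** S) x)"
      using B quad_form_congruence[of S B x] by (simp add: S pos_def_def)
  qed
  then obtain V d where V: "unitary_mat V" "\<And>i. 0 < d i"
    "S ** B ** S = V ** diag_mat (\<lambda>i. complex_of_real (d i)) ** adjoint_mat V"
    using pos_def_spectral_decomposition by blast
  define P where "P = R ** V"
  have mean: "A \<sharp>[p] B
      = R ** (V ** diag_mat (\<lambda>i. complex_of_real (d i powr p)) ** adjoint_mat V) ** R" for p
    using mat_powr_eq[OF V, of p] by (simp add: wgeo_mean_def R_def S_def)
  show thesis
  proof
    show "0 < d i" for i by (rule V)
    show "A \<sharp>[p] B = P ** diag_mat (\<lambda>i. complex_of_real (d i powr p)) ** adjoint_mat P" for p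
      by (simp add: mean P_def adjoint_mat_mult R matrix_mul_assoc)
    show "A \<sharp>[0] B = A"
      using V(1) less_imp_neq[OF V(2), THEN not_sym] R
      by (simp add: mean diag_mat_one unitary_mat_def)
    have "A \<sharp>[1] B = R ** (S ** B ** S) ** R"
      using less_imp_le[OF V(2)] by (simp add: mean V(3))
    also have "\<dots> = (R ** S) ** B ** (S ** R)"
      by (simp only: matrix_mul_assoc)
    also have "\<dots> = B"
      by (simp add: RS)
    finally show "A \<sharp>[1] B = B" .
  qed
qed

section \<open>Kronecker products\<close>

lemma kronecker_mult:
  "(A ** B) \<otimes>\<^sub>K (C ** D) = (A \<otimes>\<^sub>K C) ** (B \<otimes>\<^sub>K D)"
  by (simp add: kronecker_def matrix_matrix_mult_def vec_eq_iff sum_product sum.cartesian_product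
      case_prod_beta mult_ac)

lemma adjoint_kronecker: "adjoint_mat (A \<otimes>\<^sub>K B) = adjoint_mat A \<otimes>\<^sub>K adjoint_mat B"
  by (simp add: kronecker_def adjoint_mat_def vec_eq_iff)

lemma kronecker_diag_mat:
  "diag_mat d \<otimes>\<^sub>K diag_mat e = diag_mat (\<lambda>i. d (fst i) * e (snd i))"
  by (auto simp: kronecker_def diag_mat_def vec_eq_iff)

lemma kronecker_congruence:
  "(P ** M ** adjoint_mat P) \<otimes>\<^sub>K (Q ** N ** adjoint_mat Q)
    = (P \<otimes>\<^sub>K Q) ** (M \<otimes>\<^sub>K N) ** adjoint_mat (P \<otimes>\<^sub>K Q)"
  by (simp add: kronecker_mult adjoint_kronecker)

lemma kronecker_sum:
  "(\<Sum>i\<in>I. X i) \<otimes>\<^sub>K (\<Sum>j\<in>J. Y j) = (\<Sum>i\<in>I. \<Sum>j\<in>J. X i \<otimes>\<^sub>K Y j)"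
  by (simp add: kronecker_def vec_eq_iff sum_product)

section \<open>Monotonicity of the symmetrized products\<close>

text \<open>
  Writing \<open>a = e\<^sup>x\<close> and \<open>b = e\<^sup>y\<close>, the Heinz sum is \<open>2 e\<^bsup>(x+y)/2\<^esup> cosh ((s - 1/2) (x - y))\<close>, and \<open>cosh\<close>
  is even and increasing on the nonnegative reals.
\<close>

lemma Heinz_sum_mono:
  fixes a b :: real
  assumes "0 < a" "0 < b" "\<bar>s - 1/2\<bar> \<le> \<bar>t - 1/2\<bar>"
  shows "a powr s * b powr (1 - s) + a powr (1 - s) * b powr s
    \<le> a powr t * b powr (1 - t) + a powr (1 - t) * b powr t"
proof -
  define x y where "x = ln a" and "y = ln b"
  have Heinz: "a powr r * b powr (1 - r) + a powr (1 - r) * b powr r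
      = 2 * exp ((x + y) / 2) * cosh (\<bar>r - 1/2\<bar> * \<bar>x - y\<bar>)" for r
  proof -
    have "a powr r * b powr (1 - r) + a powr (1 - r) * b powr r
        = exp ((x + y) / 2 + (r - 1/2) * (x - y)) + exp ((x + y) / 2 - (r - 1/2) * (x - y))"
    proof -
      have exponent: "(x + y) / 2 + (r - 1/2) * (x - y) = r * x + (1 - r) * y"
        "(x + y) / 2 - (r - 1/2) * (x - y) = (1 - r) * x + r * y"
        by (simp_all add: field_simps)
      show ?thesis
        unfolding exponent exp_add using assms by (simp add: powr_def x_def y_def)
    qed
    also have "\<dots> = 2 * exp ((x + y) / 2) * cosh ((r - 1/2) * (x - y))"
    proof -
      have "exp (u + v) + exp (u - v) = 2 * exp u * cosh v" for u v :: real
        using exp_add[of u v] exp_add[of u "- v"] by (simp add: cosh_field_def distrib_left)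
      then show ?thesis .
    qed
    finally show ?thesis
      by (simp flip: abs_mult)
  qed
  have "cosh (\<bar>s - 1/2\<bar> * \<bar>x - y\<bar>) \<le> cosh (\<bar>t - 1/2\<bar> * \<bar>x - y\<bar>)"
    using assms(3) by (simp add: cosh_real_nonneg_le_iff mult_right_mono)
  then show ?thesis
    by (simp add: Heinz)
qed

lemma loewner_Heinz_kronecker:
  fixes A B :: "complex ^ 'n ^ 'n" and C D :: "complex ^ 'm ^ 'm"
  assumes "pos_def A" "pos_def B" "pos_def C" "pos_def D" "\<bar>s - 1/2\<bar> \<le> \<bar>t - 1/2\<bar>"
  shows "(A \<sharp>[s] B) \<otimes>\<^sub>K (C \<sharp>[1 - s] D) + (A \<sharp>[1 - s] B) \<otimes>\<^sub>K (C \<sharp>[s] D)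
    \<preceq>\<^sub>L (A \<sharp>[t] B) \<otimes>\<^sub>K (C \<sharp>[1 - t] D) + (A \<sharp>[1 - t] B) \<otimes>\<^sub>K (C \<sharp>[t] D)"
proof -
  obtain P :: "complex ^ 'n ^ 'n" and d where d: "\<And>i. 0 < d i"
    and P: "\<And>p. A \<sharp>[p] B = P ** diag_mat (\<lambda>i. complex_of_real (d i powr p)) ** adjoint_mat P"
    using wgeo_mean_diagonalization[OF assms(1,2)] by metis
  obtain Q :: "complex ^ 'm ^ 'm" and e where e: "\<And>i. 0 < e i"
    and Q: "\<And>p. C \<sharp>[p] D = Q ** diag_mat (\<lambda>i. complex_of_real (e i powr p)) ** adjoint_mat Q"
    using wgeo_mean_diagonalization[OF assms(3,4)] by metis
  define h where "h r i = d (fst i) powr r * e (snd i) powr (1 - r)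
      + d (fst i) powr (1 - r) * e (snd i) powr r" for r i
  have diag: "(A \<sharp>[r] B) \<otimes>\<^sub>K (C \<sharp>[1 - r] D) + (A \<sharp>[1 - r] B) \<otimes>\<^sub>K (C \<sharp>[r] D)
      = (P \<otimes>\<^sub>K Q) ** diag_mat (\<lambda>i. complex_of_real (h r i)) ** adjoint_mat (P \<otimes>\<^sub>K Q)" for r
  proof -
    let ?M = "diag_mat (\<lambda>i.
      complex_of_real (d (fst i) powr r) * complex_of_real (e (snd i) powr (1 - r)))"
    let ?N = "diag_mat (\<lambda>i.
      complex_of_real (d (fst i) powr (1 - r)) * complex_of_real (e (snd i) powr r))"
    have "(A \<sharp>[r] B) \<otimes>\<^sub>K (C \<sharp>[1 - r] D) + (A \<sharp>[1 - r] B) \<otimes>\<^sub>K (C \<sharp>[r] D)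
        = (P \<otimes>\<^sub>K Q) ** ?M ** adjoint_mat (P \<otimes>\<^sub>K Q) + (P \<otimes>\<^sub>K Q) ** ?N ** adjoint_mat (P \<otimes>\<^sub>K Q)"
      by (simp only: P Q kronecker_congruence kronecker_diag_mat)
    also have "\<dots> = (P \<otimes>\<^sub>K Q) ** (?M + ?N) ** adjoint_mat (P \<otimes>\<^sub>K Q)"
      by (simp only: matrix_add_ldistrib matrix_add_rdistrib_complex)
    also have "?M + ?N = diag_mat (\<lambda>i. complex_of_real (h r i))"
      by (simp add: diag_mat_def vec_eq_iff h_def)
    finally show ?thesis .
  qed
  show ?thesis
    unfolding diag
  proof (rule loewner_le_congruence, rule loewner_le_diag_mat)
    show "h s i \<le> h t i" for i
      unfolding h_def by (rule Heinz_sum_mono[OF d e assms(5)])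
  qed
qed

lemma loewner_Heinz_kronecker_sum:
  fixes A B :: "'k \<Rightarrow> complex ^ 'n ^ 'n"
  assumes "\<And>j. j \<in> J \<Longrightarrow> pos_def (A j)" "\<And>j. j \<in> J \<Longrightarrow> pos_def (B j)"
    "\<bar>s - 1/2\<bar> \<le> \<bar>t - 1/2\<bar>"
  shows "(\<Sum>j\<in>J. A j \<sharp>[s] B j) \<otimes>\<^sub>K (\<Sum>j\<in>J. A j \<sharp>[1 - s] B j)
      + (\<Sum>j\<in>J. A j \<sharp>[1 - s] B j) \<otimes>\<^sub>K (\<Sum>j\<in>J. A j \<sharp>[s] B j)
    \<preceq>\<^sub>L (\<Sum>j\<in>J. A j \<sharp>[t] B j) \<otimes>\<^sub>K (\<Sum>j\<in>J. A j \<sharp>[1 - t] B j)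
      + (\<Sum>j\<in>J. A j \<sharp>[1 - t] B j) \<otimes>\<^sub>K (\<Sum>j\<in>J. A j \<sharp>[t] B j)"
  unfolding kronecker_sum sum.distrib[symmetric]
  by (intro loewner_le_sum loewner_Heinz_kronecker assms)

theorem theorem3p4:
  fixes A B :: "nat \<Rightarrow> complex ^ 'n ^ 'n" and m :: nat and s t :: real
  assumes "m \<ge> 1"
    and "\<And>j. j \<in> {1..m} \<Longrightarrow> pos_def (A j)"
    and "\<And>j. j \<in> {1..m} \<Longrightarrow> pos_def (B j)"
    and "(0 \<le> t \<and> t \<le> s \<and> s \<le> 1/2) \<or> (1/2 \<le> s \<and> s \<le> t \<and> t \<le> 1)"
  shows "2 *\<^sub>R ((\<Sum>j=1..m. A j \<sharp> B j) \<otimes>\<^sub>K (\<Sum>j=1..m. A j \<sharp> B j))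
           \<preceq>\<^sub>L (\<Sum>j=1..m. A j \<sharp>[s] B j) \<otimes>\<^sub>K (\<Sum>j=1..m. A j \<sharp>[1 - s] B j)
             + (\<Sum>j=1..m. A j \<sharp>[1 - s] B j) \<otimes>\<^sub>K (\<Sum>j=1..m. A j \<sharp>[s] B j)
       \<and> (\<Sum>j=1..m. A j \<sharp>[s] B j) \<otimes>\<^sub>K (\<Sum>j=1..m. A j \<sharp>[1 - s] B j)
             + (\<Sum>j=1..m. A j \<sharp>[1 - s] B j) \<otimes>\<^sub>K (\<Sum>j=1..m. A j \<sharp>[s] B j)
           \<preceq>\<^sub>L (\<Sum>j=1..m. A j \<sharp>[t] B j) \<otimes>\<^sub>K (\<Sum>j=1..m. A j \<sharp>[1 - t] B j)
             + (\<Sum>j=1..m. A j \<sharp>[1 - t] B j) \<otimes>\<^sub>K (\<Sum>j=1..m. A j \<sharp>[t] B j)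
       \<and> (\<Sum>j=1..m. A j \<sharp>[t] B j) \<otimes>\<^sub>K (\<Sum>j=1..m. A j \<sharp>[1 - t] B j)
             + (\<Sum>j=1..m. A j \<sharp>[1 - t] B j) \<otimes>\<^sub>K (\<Sum>j=1..m. A j \<sharp>[t] B j)
           \<preceq>\<^sub>L (\<Sum>j=1..m. A j) \<otimes>\<^sub>K (\<Sum>j=1..m. B j)
             + (\<Sum>j=1..m. B j) \<otimes>\<^sub>K (\<Sum>j=1..m. A j)"
proof -
  let ?F = "\<lambda>r. (\<Sum>j=1..m. A j \<sharp>[r] B j) \<otimes>\<^sub>K (\<Sum>j=1..m. A j \<sharp>[1 - r] B j)
             + (\<Sum>j=1..m. A j \<sharp>[1 - r] B j) \<otimes>\<^sub>K (\<Sum>j=1..m. A j \<sharp>[r] B j)"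
  have mono: "?F p \<preceq>\<^sub>L ?F q" if "\<bar>p - 1/2\<bar> \<le> \<bar>q - 1/2\<bar>" for p q
    using loewner_Heinz_kronecker_sum[of "{1..m}" A B p q] assms(2,3) that by blast
  have half: "?F (1/2) = 2 *\<^sub>R ((\<Sum>j=1..m. A j \<sharp> B j) \<otimes>\<^sub>K (\<Sum>j=1..m. A j \<sharp> B j))"
    by (simp add: scaleR_2)
  have "A j \<sharp>[0] B j = A j \<and> A j \<sharp>[1] B j = B j" if "j \<in> {1..m}" for j
    using wgeo_mean_diagonalization[OF assms(2,3)[OF that]] by metis
  then have zero: "?F 0 = (\<Sum>j=1..m. A j) \<otimes>\<^sub>K (\<Sum>j=1..m. B j)
      + (\<Sum>j=1..m. B j) \<otimes>\<^sub>K (\<Sum>j=1..m. A j)"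
    by simp
  have "\<bar>1/2 - 1/2\<bar> \<le> \<bar>s - 1/2\<bar>" "\<bar>s - 1/2\<bar> \<le> \<bar>t - 1/2\<bar>" "\<bar>t - 1/2\<bar> \<le> \<bar>0 - 1/2\<bar>"
    using assms(4) by auto
  from this[THEN mono] show ?thesis
    unfolding half zero by blast
qed

end
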